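(* For every $m\ge1$, every $r\ge0$ and every word $w\in\{+,-\}^r$, $$H_w^{(m)}(x)=\sum_{k=1}^{m} C_w^{(m)}(k)\,b_{m,k}(x).$$
   Context: For $1\le k\le m$, $b_{m,k}(x)=\binom{m-1}{k-1}x^{k-1}(1-x)^{m-k}$. Endpoint counts: for a word $w=w_1\cdots w_r\in\{+,-\}^r$ and $1\le k\le m$, $C_w^{(m)}(k)$ is defined recursively by $C_\varnothing^{(m)}(k)=1$, $C_{+v}^{(m)}(k)=\sum_{\ell=k}^{m}C_v^{(m)}(\ell)$ and $C_{-v}^{(m)}(k)=\sum_{\ell=1}^{k}C_v^{(m)}(\ell)$. Equivalently it counts sequences $(g_0,\ldots,g_r)\in[m]^{r+1}$ with $g_0=k$, $g_j\ge g_{j-1}$ if $w_j=+$, and $g_j\le g_{j-1}$ if $w_j=-$. Continuous record process: for $x\in[0,1]$, $H_w^{(m)}(x)$ is the expected value of $m^N$ in the following process. Start with threshold $x$ and inspect $r$ independent uniform random variables on $[0,1]$ in order, with comparison directions $w_1,\ldots,w_r$. If the current direction is $+$, a new record occurs if the inspected value is larger than the current threshold; if it is $-$, a new record occurs if the inspected value is smaller than the current threshold. On a record the threshold is replaced by the inspected value; otherwise it is unchanged. $N$ is the number of new records among the $r$ inspected variables. Equivalently, $H_\varnothing^{(m)}(x)=1$, $H_{+v}^{(m)}(x)=xH_v^{(m)}(x)+m\int_x^1H_v^{(m)}(u)\,\mathrm{d}u$, and $H_{-v}^{(m)}(x)=(1-x)H_v^{(m)}(x)+m\int_0^xH_v^{(m)}(u)\,\mathrm{d}u$.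 *)

theory Defs
  imports "HOL-Probability.Probability"
begin

datatype direction = Plus | Minus

type_synonym word = "direction list"

text \<open>With \<open>Bernstein n j x = (n choose j) * x ^ j * (1 - x) ^ (n - j)\<close> from the library,
  the exponent of \<open>1 - x\<close> is \<open>(m - 1) - (k - 1) = m - k\<close> for \<open>1 \<le> k \<le> m\<close>.\<close>

definition bernstein_basis :: "nat \<Rightarrow> nat \<Rightarrow> real \<Rightarrow> real" where
  "bernstein_basis m k x = Bernstein (m - 1) (k - 1) x"

fun endpoint_count :: "nat \<Rightarrow> word \<Rightarrow> nat \<Rightarrow> nat" where
  "endpoint_count m [] k = 1"
| "endpoint_count m (Plus # v) k = (\<Sum>l = k..m. endpoint_count m v l)"
| "endpoint_count m (Minus # v) k = (\<Sum>l = 1..k. endpoint_count m v l)"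

fun is_record :: "direction \<Rightarrow> real \<Rightarrow> real \<Rightarrow> bool" where
  "is_record Plus t u \<longleftrightarrow> u > t"
| "is_record Minus t u \<longleftrightarrow> u < t"

text \<open>\<open>num_records w t u\<close> is the number of new records when the values
  \<open>u 0, \<dots>, u (length w - 1)\<close> are inspected in this order, starting from the threshold \<open>t\<close>.\<close>

fun num_records :: "word \<Rightarrow> real \<Rightarrow> (nat \<Rightarrow> real) \<Rightarrow> nat" where
  "num_records [] t u = 0"
| "num_records (d # v) t u =
     (if is_record d t (u 0)
      then Suc (num_records v (u 0) (\<lambda>i. u (Suc i)))
      else num_records v t (\<lambda>i. u (Suc i)))"

definition iid_uniform :: "nat \<Rightarrow> (nat \<Rightarrow> real) measure" where
  "iid_uniform r = PiM {..<r} (\<lambda>_. uniform_measure lborel {0..1})"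

definition record_expectation :: "nat \<Rightarrow> word \<Rightarrow> real \<Rightarrow> real" where
  "record_expectation m w x =
     (LINT u|iid_uniform (length w). real m ^ num_records w x u)"

end

theory Submission
  imports Defs
begin

text \<open>
  The proof is by induction on the word, with the threshold \<open>x\<close> arbitrary. It compares two one-step
  recursions.

  On the analytic side, conditioning on the first inspected value gives
  \<open>H\<^bsub>+v\<^esub>(x) = x H\<^sub>v(x) + m \<integral>\<^sub>x\<^sup>1 H\<^sub>v(u) du\<close> and
  \<open>H\<^bsub>-v\<^esub>(x) = (1 - x) H\<^sub>v(x) + m \<integral>\<^sub>0\<^sup>x H\<^sub>v(u) du\<close>
  (\<open>record_expectation_Cons\<close>, \<open>record_expectation_Cons_eqI\<close>). This rests on the fact that
  prepending an independent uniform value to a sequence of \<open>r\<close> independent uniform values gives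
  \<open>r + 1\<close> of them (\<open>distr_case_nat_iid_uniform\<close>).

  On the combinatorial side, these two integral operators act on the Bernstein basis of degree
  \<open>m - 1\<close> as partial sums: the operator for \<open>+\<close> sends \<open>b\<^bsub>m,l\<^esub>\<close> to
  \<open>b\<^bsub>m,1\<^esub> + \<dots> + b\<^bsub>m,l\<^esub>\<close> and the operator for \<open>-\<close> sends it to
  \<open>b\<^bsub>m,l\<^esub> + \<dots> + b\<^bsub>m,m\<^esub>\<close> (\<open>bernstein_basis_Plus_step\<close>,
  \<open>bernstein_basis_Minus_step\<close>). Exchanging the order of summation moves the partial sums to the
  coefficients, where they are the recursion of the endpoint counts.

  Behind the last step are two facts about the partial sums \<open>T\<^bsub>n,j\<^esub>\<close> of the Bernstein polynomials
  \<open>B\<^bsub>n,0\<^esub>, \<dots>, B\<^bsub>n,j\<^esub>\<close>. Differentiation telescopes to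
  \<open>T\<^bsub>n+1,j\<^esub>' = - (n + 1) B\<^bsub>n,j\<^esub>\<close>, so \<open>- T\<^bsub>m,l-1\<^esub>\<close> is an antiderivative of
  \<open>m b\<^bsub>m,l\<^esub>\<close>; and the Pascal recursion telescopes to
  \<open>T\<^bsub>n+1,j\<^esub> = T\<^bsub>n,j\<^esub> - x B\<^bsub>n,j\<^esub>\<close>, so the term \<open>x b\<^bsub>m,l\<^esub>\<close>, which comes from the
  first value not being a record, is exactly what brings the degree back from \<open>m\<close> to \<open>m - 1\<close>.
\<close>

section \<open>Partial sums of Bernstein polynomials\<close>

lemma Bernstein_0: "Bernstein n 0 x = (1 - x) ^ n"
  by (simp add: Bernstein_def)

lemma Bernstein_Suc_Suc:
  "Bernstein (Suc n) (Suc j) x = x * Bernstein n j x + (1 - x) * Bernstein n (Suc j) x"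
proof (cases "j < n")
  case True
  then have "n - j = Suc (n - Suc j)" by simp
  then show ?thesis by (simp add: Bernstein_def algebra_simps)
next
  case False
  then show ?thesis by (simp add: Bernstein_def binomial_eq_0)
qed

text \<open>Summing the Pascal recursion telescopes: the part \<open>x * Bernstein n i x\<close> lost by the
  term of index \<open>i\<close> is gained by the term of index \<open>i + 1\<close>, so only the loss at \<open>j\<close> remains.\<close>
lemma sum_Bernstein_Suc:
  "(\<Sum>i\<le>j. Bernstein (Suc n) i x) = (\<Sum>i\<le>j. Bernstein n i x) - x * Bernstein n j x"
  by (induction j) (simp_all add: Bernstein_0 Bernstein_Suc_Suc algebra_simps)

lemma sum_Bernstein_at_0: "(\<Sum>i\<le>j. Bernstein n i 0) = 1"
  by (induction j) (simp_all add: Bernstein_def)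

lemma sum_Bernstein_at_1: "j < n \<Longrightarrow> (\<Sum>i\<le>j. Bernstein n i 1) = 0"
  by (auto simp: Bernstein_def power_0_left intro!: sum.neutral)

lemma DERIV_Bernstein_Suc_Suc:
  "((\<lambda>x. Bernstein (Suc n) (Suc j) x) has_real_derivative
     real (Suc n) * (Bernstein n j x - Bernstein n (Suc j) x)) (at x)"
proof -
  \<comment> \<open>Both absorption identities move the factors produced by differentiation into the
    binomial coefficients of degree \<open>n\<close>.\<close>
  have c1: "real (Suc j) * real (Suc n choose Suc j) = real (Suc n) * real (n choose j)"
    using Suc_times_binomial[of j n] by (metis of_nat_mult)
  have c2: "real (n - j) * real (Suc n choose Suc j) = real (Suc n) * real (n choose Suc j)"
  proof (cases "j \<le> n")
    case True
    have "real (Suc n choose Suc j) * (real (Suc n) - real (Suc j))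
        = real (Suc n) * real (Suc n choose Suc j) - real (Suc n) * real (n choose j)"
      using c1 by (simp only: algebra_simps)
    with True show ?thesis by (simp add: of_nat_diff algebra_simps)
  qed (simp add: binomial_eq_0)
  have "((\<lambda>x. Bernstein (Suc n) (Suc j) x) has_real_derivative
     real (Suc n choose Suc j) * (real (Suc j) * x ^ j * (1 - x) ^ (n - j)
       - x ^ Suc j * (real (n - j) * (1 - x) ^ (n - j - 1)))) (at x)"
    unfolding Bernstein_def
    by (auto intro!: derivative_eq_intros simp: algebra_simps) (cases j; simp add: algebra_simps)
  also have "real (Suc n choose Suc j) * (real (Suc j) * x ^ j * (1 - x) ^ (n - j)
       - x ^ Suc j * (real (n - j) * (1 - x) ^ (n - j - 1)))
     = (real (Suc j) * real (Suc n choose Suc j)) * (x ^ j * (1 - x) ^ (n - j))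
       - (real (n - j) * real (Suc n choose Suc j)) * (x ^ Suc j * (1 - x) ^ (n - j - 1))"
    by (simp only: algebra_simps)
  also have "\<dots> = real (Suc n) * (Bernstein n j x - Bernstein n (Suc j) x)"
    unfolding c1 c2 by (simp add: Bernstein_def algebra_simps)
  finally show ?thesis .
qed

text \<open>The derivative of each Bernstein polynomial is a difference of two neighbours of lower degree,
  so the derivative of the partial sum telescopes. For \<open>j \<le> n\<close> this gives an antiderivative
  of a single Bernstein polynomial, up to a factor, that vanishes at 1.\<close>
lemma DERIV_sum_Bernstein:
  "((\<lambda>x. \<Sum>i\<le>j. Bernstein (Suc n) i x) has_real_derivative
     - (real (Suc n) * Bernstein n j x)) (at x)"
proof (induction j)
  case 0
  show ?case
    unfolding Bernstein_def
    by (auto intro!: derivative_eq_intros) (cases n; simp add: algebra_simps)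
next
  case (Suc j)
  show ?case
    using DERIV_add[OF Suc DERIV_Bernstein_Suc_Suc[of n j x]] by (simp add: algebra_simps)
qed

section \<open>The first inspected value\<close>

abbreviation uniform01 :: "real measure" where
  "uniform01 \<equiv> uniform_measure lborel {0..1}"

lemma prob_space_uniform01: "prob_space uniform01"
  by (intro prob_space_uniform_measure) simp_all

lemma prob_space_iid_uniform: "prob_space (iid_uniform r)"
  unfolding iid_uniform_def by (intro prob_space_PiM prob_space_uniform01)

text \<open>\<open>case_nat y u\<close> is the sequence \<open>u\<close> with \<open>y\<close> prepended. Extensionality is preserved: outside the
  index range the shifted sequence takes the same default value \<open>undefined\<close>.\<close>
lemma case_nat_in_PiE_iff:
  "case_nat y u \<in> Pi\<^sub>E {..<Suc r} A \<longleftrightarrow> y \<in> A 0 \<and> u \<in> Pi\<^sub>E {..<r} (\<lambda>i. A (Suc i))"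
proof -
  have all_nat: "(\<forall>i::nat. Q i) \<longleftrightarrow> Q 0 \<and> (\<forall>i. Q (Suc i))" for Q
    by (metis nat.exhaust)
  show ?thesis
    unfolding PiE_iff extensional_def Ball_def mem_Collect_eq
    by (subst (1 2) all_nat) auto
qed

lemma measurable_case_nat_iid_uniform [measurable]:
  "(\<lambda>(y, u). case_nat y u) \<in> uniform01 \<Otimes>\<^sub>M iid_uniform r \<rightarrow>\<^sub>M iid_uniform (Suc r)"
proof -
  let ?M = "uniform01 \<Otimes>\<^sub>M PiM {..<r} (\<lambda>_. uniform01)"
  have "(\<lambda>z i. case_nat (fst z) (snd z) i) \<in> ?M \<rightarrow>\<^sub>M PiM {..<Suc r} (\<lambda>_. uniform01)"
  proof (rule measurable_PiM_single')
    fix i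
    assume "i \<in> {..<Suc r}"
    then show "(\<lambda>z. case_nat (fst z) (snd z) i) \<in> ?M \<rightarrow>\<^sub>M uniform01"
      by (cases i) (auto intro: measurable_fst
          measurable_compose[OF measurable_snd measurable_component_singleton])
  next
    show "(\<lambda>z i. case_nat (fst z) (snd z) i) \<in> space ?M \<rightarrow> ({..<Suc r} \<rightarrow>\<^sub>E space uniform01)"
      by (rule Pi_I) (simp add: space_pair_measure space_PiM mem_Times_iff case_nat_in_PiE_iff)
  qed
  then show ?thesis
    by (simp add: iid_uniform_def case_prod_unfold)
qed

text \<open>It is enough to compare both measures on boxes, where each is a product of the probabilities of
  the sides.\<close>
lemma distr_case_nat_iid_uniform:
  "distr (uniform01 \<Otimes>\<^sub>M iid_uniform r) (iid_uniform (Suc r)) (\<lambda>(y, u). case_nat y u)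
     = iid_uniform (Suc r)"
proof -
  interpret U: prob_space uniform01 by (rule prob_space_uniform01)
  interpret I: prob_space "iid_uniform r" by (rule prob_space_iid_uniform)
  interpret P: product_prob_space "\<lambda>_::nat. uniform01" UNIV by standard
  show ?thesis
    unfolding iid_uniform_def[of "Suc r"]
  proof (rule P.PiM_eqI)
    fix A :: "nat \<Rightarrow> real set"
    assume A: "\<And>i. i \<in> {..<Suc r} \<Longrightarrow> A i \<in> sets uniform01"
    have A0: "A 0 \<in> sets uniform01" using A by simp
    have A1: "Pi\<^sub>E {..<r} (\<lambda>i. A (Suc i)) \<in> sets (iid_uniform r)"
      unfolding iid_uniform_def using A by (intro sets_PiM_I_finite) auto
    have AS: "Pi\<^sub>E {..<Suc r} A \<in> sets (iid_uniform (Suc r))"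
      unfolding iid_uniform_def using A by (intro sets_PiM_I_finite) auto
    have "(\<lambda>(y, u). case_nat y u) -` Pi\<^sub>E {..<Suc r} A \<inter> space (uniform01 \<Otimes>\<^sub>M iid_uniform r)
        = A 0 \<times> Pi\<^sub>E {..<r} (\<lambda>i. A (Suc i))"
      using sets.sets_into_space[OF A1]
      by (simp add: set_eq_iff case_prod_beta space_pair_measure mem_Times_iff case_nat_in_PiE_iff)
        blast
    then have "emeasure (distr (uniform01 \<Otimes>\<^sub>M iid_uniform r) (iid_uniform (Suc r))
          (\<lambda>(y, u). case_nat y u)) (Pi\<^sub>E {..<Suc r} A)
        = emeasure (uniform01 \<Otimes>\<^sub>M iid_uniform r) (A 0 \<times> Pi\<^sub>E {..<r} (\<lambda>i. A (Suc i)))"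
      using AS by (subst emeasure_distr) auto
    also have "\<dots> = emeasure uniform01 (A 0)
        * emeasure (iid_uniform r) (Pi\<^sub>E {..<r} (\<lambda>i. A (Suc i)))"
      using A0 A1 by (rule I.emeasure_pair_measure_Times)
    also have "emeasure (iid_uniform r) (Pi\<^sub>E {..<r} (\<lambda>i. A (Suc i)))
        = (\<Prod>i<r. emeasure uniform01 (A (Suc i)))"
      unfolding iid_uniform_def using A by (intro P.emeasure_PiM) auto
    also have "emeasure uniform01 (A 0) * \<dots> = (\<Prod>i<Suc r. emeasure uniform01 (A i))"
      by (simp only: prod.lessThan_Suc_shift)
    finally show "emeasure (distr (uniform01 \<Otimes>\<^sub>M iid_uniform r) (Pi\<^sub>M {..<Suc r} (\<lambda>_. uniform01))
          (\<lambda>(y, u). case_nat y u)) (Pi\<^sub>E {..<Suc r} A)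
        = (\<Prod>i<Suc r. emeasure uniform01 (A i))"
      by (simp add: iid_uniform_def)
  qed (simp_all add: iid_uniform_def)
qed

text \<open>Measurability is needed jointly in the threshold and the values, because a record makes the first
  value the new threshold.\<close>
lemma measurable_num_records:
  "(\<lambda>(t, u). num_records w t u) \<in> borel \<Otimes>\<^sub>M iid_uniform (length w) \<rightarrow>\<^sub>M count_space UNIV"
proof (induction w)
  case Nil
  show ?case by (simp add: case_prod_beta)
next
  case (Cons d v)
  let ?N = "borel \<Otimes>\<^sub>M iid_uniform (length (d # v)) :: (real \<times> (nat \<Rightarrow> real)) measure"
  have comp: "(\<lambda>z. snd z i) \<in> ?N \<rightarrow>\<^sub>M uniform01" if "i < length (d # v)" for i
    unfolding iid_uniform_def using that
    by (intro measurable_compose[OF measurable_snd measurable_component_singleton]) simp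
  have fst: "fst \<in> borel_measurable ?N"
    by (rule measurable_fst)
  have "(\<lambda>z. snd z 0) \<in> ?N \<rightarrow>\<^sub>M uniform01"
    by (rule comp) simp
  then have first: "(\<lambda>z. snd z 0) \<in> borel_measurable ?N"
    by (simp cong: measurable_cong_sets)
  have rest: "(\<lambda>z i. snd z (Suc i)) \<in> ?N \<rightarrow>\<^sub>M iid_uniform (length v)"
    unfolding iid_uniform_def[of "length v"]
  proof (rule measurable_PiM_single')
    show "(\<lambda>z. snd z (Suc i)) \<in> ?N \<rightarrow>\<^sub>M uniform01" if "i \<in> {..<length v}" for i
      using that by (intro comp) simp
    show "(\<lambda>z i. snd z (Suc i)) \<in> space ?N \<rightarrow> ({..<length v} \<rightarrow>\<^sub>E space uniform01)"
      by (auto simp: iid_uniform_def space_pair_measure space_PiM PiE_iff extensional_def)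
  qed
  have "Measurable.pred ?N (\<lambda>z. is_record d (fst z) (snd z 0))"
    using fst first by (cases d) simp_all
  moreover have "(\<lambda>z. num_records v (fst z) (\<lambda>i. snd z (Suc i))) \<in> ?N \<rightarrow>\<^sub>M count_space UNIV"
    using measurable_compose[OF measurable_Pair[OF fst rest] Cons.IH] by simp
  moreover have "(\<lambda>z. num_records v (snd z 0) (\<lambda>i. snd z (Suc i))) \<in> ?N \<rightarrow>\<^sub>M count_space UNIV"
    using measurable_compose[OF measurable_Pair[OF first rest] Cons.IH] by simp
  ultimately show ?case
    unfolding case_prod_unfold num_records.simps
    by (intro measurable_If predE measurable_compose[OF _ measurable_count_space[of Suc]])
qed

lemma num_records_le_length: "num_records w t u \<le> length w"
proof (induction w arbitrary: t u)
  case (Cons d v)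
  show ?case using Cons[of "u 0"] Cons[of t] by (auto intro: le_SucI)
qed simp

text \<open>A bound by a constant makes the integrand integrable, as Fubini requires. The base is
  \<open>1 + m\<close> so that the power is monotone in the exponent even for \<open>m = 0\<close>.\<close>
lemma norm_power_num_records_le: "norm (real m ^ num_records w t u) \<le> (1 + real m) ^ length w"
proof -
  have "real m ^ num_records w t u \<le> (1 + real m) ^ num_records w t u"
    by (intro power_mono) auto
  also have "\<dots> \<le> (1 + real m) ^ length w"
    by (intro power_increasing num_records_le_length) auto
  finally show ?thesis by simp
qed

lemma measurable_num_records_from [measurable]:
  "num_records w t \<in> iid_uniform (length w) \<rightarrow>\<^sub>M count_space UNIV"
  using measurable_compose[OF measurable_Pair1' measurable_num_records[of w], of t] by simp

text \<open>Fubini, applied to the splitting of the sequence into its first value and the rest: once the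
  first value is fixed, the rest is the same process with the shorter word.\<close>
lemma record_expectation_Cons:
  "record_expectation m (d # v) x =
     (LINT y|uniform01. (if is_record d x y then real m * record_expectation m v y
                         else record_expectation m v x))"
proof -
  define f where "f u = real m ^ num_records (d # v) x u" for u
  let ?r = "length v"
  let ?M = "uniform01 \<Otimes>\<^sub>M iid_uniform ?r"
  let ?c = "\<lambda>(y, u). case_nat y u :: nat \<Rightarrow> real"
  interpret U: prob_space uniform01 by (rule prob_space_uniform01)
  interpret I: prob_space "iid_uniform ?r" by (rule prob_space_iid_uniform)
  interpret UI: pair_prob_space uniform01 "iid_uniform ?r" by standard
  have f: "f \<in> borel_measurable (iid_uniform (Suc ?r))"
    unfolding f_def
    using measurable_compose[OF measurable_num_records_from[of "d # v" x],
        of "\<lambda>k. real m ^ k" borel]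
    by (simp del: num_records.simps)
  have int: "integrable ?M (\<lambda>z. f (?c z))"
  proof (rule UI.P.integrable_const_bound)
    show "AE z in ?M. norm (f (?c z)) \<le> (1 + real m) ^ length (d # v)"
      unfolding f_def by (intro AE_I2 norm_power_num_records_le)
    show "(\<lambda>z. f (?c z)) \<in> borel_measurable ?M"
      by (rule measurable_compose[OF measurable_case_nat_iid_uniform f])
  qed
  have "record_expectation m (d # v) x = (LINT u|iid_uniform (Suc ?r). f u)"
    unfolding record_expectation_def f_def by (simp only: list.size add_Suc_right add_0_right)
  also have "\<dots> = (LINT u|distr ?M (iid_uniform (Suc ?r)) ?c. f u)"
    by (simp only: distr_case_nat_iid_uniform)
  also have "\<dots> = (LINT z|?M. f (?c z))"
    by (rule integral_distr[OF measurable_case_nat_iid_uniform f])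
  also have "\<dots> = (LINT y|uniform01. LINT u|iid_uniform ?r. f (?c (y, u)))"
    by (rule UI.integral_fst'[OF int, symmetric])
  also have "\<dots> = (LINT y|uniform01. (if is_record d x y then real m * record_expectation m v y
                         else record_expectation m v x))"
    by (intro Bochner_Integration.integral_cong) (simp_all add: f_def record_expectation_def)
  finally show ?thesis .
qed

section \<open>The integral recursion\<close>

lemma integral_uniform01:
  fixes f :: "real \<Rightarrow> real"
  assumes [measurable]: "f \<in> borel_measurable borel"
  shows "(LINT y|uniform01. f y) = (LINT y|lborel. f y * indicator {0..1} y)"
proof -
  have "uniform01 = density lborel (\<lambda>y. ennreal (indicator {0..1} y))"
    unfolding uniform_measure_def by (simp add: ennreal_indicator divide_ennreal_def)
  then show ?thesis
    by (simp add: integral_density mult.commute)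
qed

text \<open>The integrand may take any value at the threshold \<open>x\<close> itself, which is a null set. This is why
  strict and weak comparisons with the threshold are interchangeable.\<close>
lemma integral_uniform01_split:
  fixes F G :: "real \<Rightarrow> real"
  assumes x: "0 \<le> x" "x \<le> 1"
    and F: "\<And>y. (F has_real_derivative f y) (at y)" "\<And>y. isCont f y"
    and G: "\<And>y. (G has_real_derivative g y) (at y)" "\<And>y. isCont g y"
    and h: "\<And>y. y < x \<Longrightarrow> h y = f y" "\<And>y. x < y \<Longrightarrow> h y = g y" "h \<in> borel_measurable borel"
  shows "(LINT y|uniform01. h y) = (F x - F 0) + (G 1 - G x)"
proof -
  have [measurable]: "h \<in> borel_measurable borel" by fact
  have [measurable]: "f \<in> borel_measurable borel" "g \<in> borel_measurable borel"
    using F(2) G(2)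
    by (auto intro!: borel_measurable_continuous_onI continuous_at_imp_continuous_on)
  have "has_bochner_integral lborel (\<lambda>y. f y * indicator {0..x} y) (F x - F 0)"
    using x F by (intro has_bochner_integral_FTC_Icc_real) auto
  moreover have "has_bochner_integral lborel (\<lambda>y. g y * indicator {x..1} y) (G 1 - G x)"
    using x G by (intro has_bochner_integral_FTC_Icc_real) auto
  ultimately have *: "has_bochner_integral lborel
      (\<lambda>y. f y * indicator {0..x} y + g y * indicator {x..1} y) ((F x - F 0) + (G 1 - G x))"
    by (rule has_bochner_integral_add)
  have "(LINT y|uniform01. h y) = (LINT y|lborel. h y * indicator {0..1} y)"
    by (rule integral_uniform01) fact
  also have "\<dots> = (LINT y|lborel. f y * indicator {0..x} y + g y * indicator {x..1} y)"
  proof (rule integral_cong_AE)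
    show "AE y in lborel. h y * indicator {0..1} y
        = f y * indicator {0..x} y + g y * indicator {x..1} y"
      using AE_lborel_singleton[of x]
    proof eventually_elim
      case (elim y)
      then show ?case
        using x h(1)[of y] h(2)[of y] by (cases "y < x") (auto simp: indicator_def)
    qed
  qed measurable
  also have "\<dots> = (F x - F 0) + (G 1 - G x)"
    using * by (rule has_bochner_integral_integral_eq)
  finally show ?thesis .
qed

lemma borel_measurable_record_expectation [measurable]:
  "record_expectation m w \<in> borel_measurable borel"
proof -
  interpret I: prob_space "iid_uniform (length w)" by (rule prob_space_iid_uniform)
  have "(\<lambda>(t, u). real m ^ num_records w t u)
      \<in> borel_measurable (borel \<Otimes>\<^sub>M iid_uniform (length w))"
    using measurable_compose[OF measurable_num_records[of w], of "\<lambda>k. real m ^ k" borel]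
    by (simp add: case_prod_beta)
  then show ?thesis
    unfolding record_expectation_def by (rule I.borel_measurable_lebesgue_integral)
qed

text \<open>The integral recursion with the integrals written as increments of an antiderivative \<open>G\<close> of
  \<open>m * P\<close>. The values of \<open>P\<close> matter on the unit interval only, since almost all inspected values
  lie there; the regularity assumptions hold on all of \<open>\<real>\<close> for the polynomials of interest.\<close>
lemma record_expectation_Cons_eqI:
  assumes x: "0 \<le> x" "x \<le> 1"
    and P: "\<And>y. 0 \<le> y \<Longrightarrow> y \<le> 1 \<Longrightarrow> record_expectation m v y = P y" "\<And>y. isCont P y"
    and G: "\<And>y. (G has_real_derivative real m * P y) (at y)"
  shows "record_expectation m (Plus # v) x = x * P x + (G 1 - G x)"
    and "record_expectation m (Minus # v) x = (1 - x) * P x + (G x - G 0)"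
proof -
  have [measurable]: "P \<in> borel_measurable borel"
    using P(2) by (auto intro!: borel_measurable_continuous_onI continuous_at_imp_continuous_on)
  have rec [measurable]: "Measurable.pred borel (\<lambda>y. is_record d x y)" for d
    by (cases d) (simp_all only: is_record.simps, measurable)
  have E: "record_expectation m (d # v) x
      = (LINT y|uniform01. (if is_record d x y then real m * P y else P x))" for d
    unfolding record_expectation_Cons
  proof (rule integral_cong_AE)
    show "AE y in uniform01. (if is_record d x y then real m * record_expectation m v y
        else record_expectation m v x) = (if is_record d x y then real m * P y else P x)"
      using x P(1) by (intro AE_uniform_measureI AE_I2) auto
  qed (simp_all add: measurable_cong_sets[OF sets_uniform_measure refl])
  \<comment> \<open>On the side of \<open>x\<close> without records the integrand is the constant \<open>P x\<close>.\<close>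
  have const: "((\<lambda>y. P x * y) has_real_derivative P x) (at y)" for y
    by (auto intro!: derivative_eq_intros)
  have cont: "isCont (\<lambda>y. real m * P y) y" for y
    using P(2) by (intro continuous_intros)
  show "record_expectation m (Plus # v) x = x * P x + (G 1 - G x)"
    unfolding E using rec[of Plus]
    by (subst integral_uniform01_split[OF x const _ G cont]) (auto simp: mult.commute)
  show "record_expectation m (Minus # v) x = (1 - x) * P x + (G x - G 0)"
    unfolding E using rec[of Minus]
    by (subst integral_uniform01_split[OF x G cont const]) (auto simp: algebra_simps)
qed

section \<open>Expansion in the Bernstein basis\<close>

lemma sum_bernstein_basis:
  assumes "1 \<le> l"
  shows "(\<Sum>k = 1..l. bernstein_basis m k x) = (\<Sum>i\<le>l - 1. Bernstein (m - 1) i x)"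
proof -
  have "(\<Sum>k = 1..l. bernstein_basis m k x) = (\<Sum>k = Suc 0..Suc (l - 1). bernstein_basis m k x)"
    using assms by simp
  also have "\<dots> = (\<Sum>i\<le>l - 1. Bernstein (m - 1) i x)"
    unfolding sum.shift_bounds_cl_Suc_ivl
    by (simp add: bernstein_basis_def atMost_atLeast0)
  finally show ?thesis .
qed

text \<open>The left-hand side is \<open>x * b x + m * \<integral>\<^sub>x\<^sup>1 b u du\<close> for \<open>b = bernstein_basis m l\<close>, with the
  integral evaluated by \<open>DERIV_sum_Bernstein\<close>.\<close>
lemma bernstein_basis_Plus_step:
  assumes "1 \<le> l" "l \<le> m"
  shows "x * bernstein_basis m l x + (\<Sum>i\<le>l - 1. Bernstein m i x)
    = (\<Sum>k = 1..l. bernstein_basis m k x)"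
  using assms sum_Bernstein_Suc[of "m - 1" x "l - 1"]
  by (simp only: sum_bernstein_basis) (simp add: bernstein_basis_def)

text \<open>The left-hand side is \<open>(1 - x) * b x + m * \<integral>\<^sub>0\<^sup>x b u du\<close> for \<open>b = bernstein_basis m l\<close>. Adding it
  to the expression for \<open>Plus\<close> gives \<open>b x + 1\<close>, so the claim follows from the previous one because
  the basis sums to 1.\<close>
lemma bernstein_basis_Minus_step:
  assumes "1 \<le> l" "l \<le> m"
  shows "(1 - x) * bernstein_basis m l x + (1 - (\<Sum>i\<le>l - 1. Bernstein m i x))
    = (\<Sum>k = l..m. bernstein_basis m k x)"
proof -
  have "(\<Sum>k = 1..m. bernstein_basis m k x) = 1"
    using assms sum_Bernstein[of "m - 1" x] by (simp only: sum_bernstein_basis)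
  moreover have "(\<Sum>k = 1..m. bernstein_basis m k x)
      = (\<Sum>k = 1..l. bernstein_basis m k x) + (\<Sum>k = Suc l..m. bernstein_basis m k x)"
    using assms sum.ub_add_nat[of 1 l "\<lambda>k. bernstein_basis m k x" "m - l"] by simp
  moreover have "(\<Sum>k = l..m. bernstein_basis m k x)
      = bernstein_basis m l x + (\<Sum>k = Suc l..m. bernstein_basis m k x)"
    using assms by (simp add: sum.atLeast_Suc_atMost)
  ultimately show ?thesis
    using bernstein_basis_Plus_step[OF assms, of x] by (simp add: algebra_simps)
qed

lemma sum_atLeastAtMost_triangle:
  fixes a b :: "nat \<Rightarrow> real"
  shows "(\<Sum>l = 1..m. a l * (\<Sum>k = 1..l. b k)) = (\<Sum>k = 1..m. (\<Sum>l = k..m. a l) * b k)"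
proof -
  have "(\<Sum>l = 1..m. a l * (\<Sum>k = 1..l. b k))
      = (\<Sum>l = 1..m. \<Sum>k | k \<in> {1..m} \<and> k \<le> l. a l * b k)"
    unfolding sum_distrib_left by (intro sum.cong) auto
  also have "\<dots> = (\<Sum>k = 1..m. \<Sum>l | l \<in> {1..m} \<and> k \<le> l. a l * b k)"
    by (intro sum.swap_restrict) auto
  also have "\<dots> = (\<Sum>k = 1..m. (\<Sum>l = k..m. a l) * b k)"
    unfolding sum_distrib_right by (intro sum.cong) auto
  finally show ?thesis .
qed

theorem lemma3p5:
  fixes m r :: nat and w :: word and x :: real
  assumes "m \<ge> 1" and "length w = r" and "0 \<le> x" and "x \<le> 1"
  shows "record_expectation m w x =
           (\<Sum>k = 1..m. real (endpoint_count m w k) * bernstein_basis m k x)"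
  using assms(3,4)
proof (induction w arbitrary: x)
  case Nil
  interpret prob_space "iid_uniform 0" by (rule prob_space_iid_uniform)
  have "record_expectation m [] x = 1"
    by (simp add: record_expectation_def prob_space)
  moreover have "(\<Sum>k = 1..m. bernstein_basis m k x) = 1"
    using assms(1) sum_Bernstein[of "m - 1" x] by (simp only: sum_bernstein_basis)
  ultimately show ?case by simp
next
  case (Cons d v)
  let ?c = "\<lambda>k. real (endpoint_count m v k)"
  let ?P = "\<lambda>y. \<Sum>k = 1..m. ?c k * bernstein_basis m k y"
  \<comment> \<open>\<open>?G\<close> is an antiderivative of \<open>m * ?P\<close>, built term by term from \<open>DERIV_sum_Bernstein\<close>.\<close>
  let ?T = "\<lambda>k y. \<Sum>i\<le>k - 1. Bernstein m i y"
  let ?G = "\<lambda>y. - (\<Sum>k = 1..m. ?c k * ?T k y)"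
  have dT: "(?T k has_real_derivative - (real m * bernstein_basis m k y)) (at y)" for k y
    using DERIV_sum_Bernstein[of "m - 1" "k - 1" y] assms(1) by (simp add: bernstein_basis_def)
  have G: "(?G has_real_derivative real m * ?P y) (at y)" for y
    by (rule derivative_eq_intros dT refl)+ (simp add: sum_negf sum_distrib_left mult_ac)
  have P: "isCont ?P y" for y
    unfolding bernstein_basis_def Bernstein_def by (intro continuous_intros)
  note step = record_expectation_Cons_eqI[OF Cons.prems Cons.IH P G]
  have T1: "?T k 1 = 0" if "k \<in> {1..m}" for k
    using that by (intro sum_Bernstein_at_1) auto
  show ?case
  proof (cases d)
    case Plus
    have "record_expectation m (Plus # v) x = x * ?P x + (?G 1 - ?G x)"
      by (rule step(1))
    also have "\<dots> = (\<Sum>l = 1..m. ?c l * (x * bernstein_basis m l x + ?T l x))"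
      \<comment> \<open>The boundary terms at 1 vanish: a partial sum up to \<open>k - 1 < m\<close> omits the only
        Bernstein polynomial of degree \<open>m\<close> that is nonzero there.\<close>
      using T1 by (simp add: sum_distrib_left sum.distrib algebra_simps)
    also have "\<dots> = (\<Sum>l = 1..m. ?c l * (\<Sum>k = 1..l. bernstein_basis m k x))"
      by (intro sum.cong refl) (simp only: bernstein_basis_Plus_step atLeastAtMost_iff)
    also have "\<dots> = (\<Sum>k = 1..m. (\<Sum>l = k..m. ?c l) * bernstein_basis m k x)"
      by (rule sum_atLeastAtMost_triangle)
    finally show ?thesis by (simp add: Plus)
  next
    case Minus
    have "record_expectation m (Minus # v) x = (1 - x) * ?P x + (?G x - ?G 0)"
      by (rule step(2))
    also have "\<dots> = (\<Sum>l = 1..m. ?c l * ((1 - x) * bernstein_basis m l x + (1 - ?T l x)))"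
      by (simp only: sum_Bernstein_at_0)
        (simp add: sum_distrib_left sum.distrib sum_subtractf algebra_simps)
    also have "\<dots> = (\<Sum>l = 1..m. ?c l * (\<Sum>k = l..m. bernstein_basis m k x))"
      by (intro sum.cong refl) (simp only: bernstein_basis_Minus_step atLeastAtMost_iff)
    also have "\<dots> = (\<Sum>k = 1..m. (\<Sum>l = 1..k. ?c l) * bernstein_basis m k x)"
      \<comment> \<open>The triangle identity with the roles of coefficients and basis exchanged.\<close>
      using sum_atLeastAtMost_triangle[of "\<lambda>k. bernstein_basis m k x" ?c m]
      by (simp only: mult.commute)
    finally show ?thesis by (simp add: Minus)
  qed
qed

end
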